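(* For every integer $n\geq 6$ there exist two extremal arrays $A,B\in\mathcal{S}_{n,n+1}$ that have the same set of entries counted with multiplicities (i.e. the multisets of entries of $A$ and of $B$ coincide), but such that $A$ and $B$ are not equivalent.
   Context: An $n\times m$ real matrix $A=(a_{ij})$ is called a doubly stochastic array (with uniform marginals) if $a_{ij}\geq 0$ for all $i,j$, $\sum_{j=1}^m a_{ij}=m$ for every $1\leq i\leq n$, and $\sum_{i=1}^n a_{ij}=n$ for every $1\leq j\leq m$. The set of all such arrays is denoted $\mathcal{S}_{n,m}$; it is a convex polytope. An array $A\in\mathcal{S}_{n,m}$ is called extremal if it is an extreme point of $\mathcal{S}_{n,m}$, i.e. it cannot be represented as a convex combination of two other elements of $\mathcal{S}_{n,m}$ that are both different from $A$. Two $n\times m$ matrices are called equivalent if one can be transformed into the other by a permutation of rows and columns. *)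

theory Defs
  imports
    Complex_Main
    "HOL-Library.Multiset"
    "HOL-Combinatorics.Permutations"
    "Jordan_Normal_Form.Matrix"
begin

text \<open>
  Matrix indices start at 0, as usual for \<^typ>\<open>real mat\<close>. The marginals are not normalised to 1:
  each of the \<open>n\<close> rows sums to \<open>m\<close> and each of the \<open>m\<close> columns sums to \<open>n\<close>.
\<close>

definition ds_arrays :: "nat \<Rightarrow> nat \<Rightarrow> real mat set" where
  "ds_arrays n m = {A \<in> carrier_mat n m.
     (\<forall>i<n. \<forall>j<m. 0 \<le> A $$ (i, j)) \<and>
     (\<forall>i<n. (\<Sum>j<m. A $$ (i, j)) = real m) \<and>
     (\<forall>j<m. (\<Sum>i<n. A $$ (i, j)) = real n)}"

text \<open>
  The library notion of extreme point needs a \<open>real_vector\<close> type, which \<^typ>\<open>real mat\<close> is not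
  (its dimensions are part of the value), so extremality is spelled out.
\<close>

definition extremal_array :: "nat \<Rightarrow> nat \<Rightarrow> real mat \<Rightarrow> bool" where
  "extremal_array n m A \<longleftrightarrow> A \<in> ds_arrays n m \<and>
     \<not> (\<exists>X \<in> ds_arrays n m. \<exists>Y \<in> ds_arrays n m. \<exists>t::real.
          X \<noteq> A \<and> Y \<noteq> A \<and> 0 \<le> t \<and> t \<le> 1 \<and> A = t \<cdot>\<^sub>m X + (1 - t) \<cdot>\<^sub>m Y)"

definition entries_mset :: "'a mat \<Rightarrow> 'a multiset" where
  "entries_mset A = image_mset (($$) A) (mset_set ({..<dim_row A} \<times> {..<dim_col A}))"

definition equivalent_mat :: "'a mat \<Rightarrow> 'a mat \<Rightarrow> bool" where
  "equivalent_mat A B \<longleftrightarrow> (\<exists>p q. p permutes {..<dim_row A} \<and> q permutes {..<dim_col A} \<and>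
     B = mat (dim_row A) (dim_col A) (\<lambda>(i, j). A $$ (p i, q j)))"

end

theory Submission
  imports Defs
begin

text \<open>
  A tree with vertices \<open>0, \<dots>, n\<close> has \<open>n\<close> edges, and it yields an extremal \<open>n \<times> (n + 1)\<close> array whose
  columns are the vertices and whose rows are the edges. Removing an edge \<open>uv\<close> leaves a component
  of \<open>k\<close> vertices around \<open>u\<close> and one of \<open>n + 1 - k\<close> vertices around \<open>v\<close>; the row of \<open>uv\<close> has the entry
  \<open>n + 1 - k\<close> in column \<open>u\<close>, the entry \<open>k\<close> in column \<open>v\<close>, and zeros elsewhere. The row sums are
  obvious, and a column sum is right because the branches hanging off a vertex contain all the
  other \<open>n\<close> vertices. The array is extremal because the marginals determine the flow along
  the edges of a tree, so no other doubly stochastic array has its support inside that of this one.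

  The non-zero entries thus record only the sizes of the two parts into which each edge splits the
  tree, whereas a permutation of rows and columns preserves in addition the vertex degrees, that is,
  the numbers of non-zero entries in the columns. It remains to find two trees with the same edge
  splits but different degrees. Take a central vertex with pendant leaves and attach to it

    \<^item> a path of three vertices, joined to the centre by an end, or

    \<^item> a path of two vertices, joined by an end, and a path of three vertices, joined by its middle.

  If the number of leaves makes the total \<open>n + 1\<close> in both cases, then in both trees the edges cut off
  one part of size three, one of size two, and otherwise single vertices. But the centre has
  degree \<open>n - 2\<close> in the first tree, and for \<open>n \<ge> 6\<close> no vertex of the second tree has this degree.
\<close>

section \<open>A support criterion for extremality\<close>

text \<open>
  In a proper convex combination of non-negative arrays nothing cancels, so both summands vanish
  wherever the combination does.
\<close>

lemma extremal_array_if_determined_by_support: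
  assumes A: "A \<in> ds_arrays n m"
    and unique: "\<And>X. X \<in> ds_arrays n m \<Longrightarrow>
      (\<And>i j. i < n \<Longrightarrow> j < m \<Longrightarrow> A $$ (i, j) = 0 \<Longrightarrow> X $$ (i, j) = 0) \<Longrightarrow> X = A"
  shows "extremal_array n m A"
  unfolding extremal_array_def
proof (intro conjI notI)
  assume "\<exists>X \<in> ds_arrays n m. \<exists>Y \<in> ds_arrays n m. \<exists>t::real.
    X \<noteq> A \<and> Y \<noteq> A \<and> 0 \<le> t \<and> t \<le> 1 \<and> A = t \<cdot>\<^sub>m X + (1 - t) \<cdot>\<^sub>m Y"
  then obtain X Y t where X: "X \<in> ds_arrays n m" and Y: "Y \<in> ds_arrays n m"
    and ne: "X \<noteq> A" "Y \<noteq> A" and t: "0 \<le> t" "t \<le> 1"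
    and comb: "A = t \<cdot>\<^sub>m X + (1 - t) \<cdot>\<^sub>m Y"
    by blast
  have carr: "X \<in> carrier_mat n m" "Y \<in> carrier_mat n m" "A \<in> carrier_mat n m"
    using X Y A by (auto simp: ds_arrays_def)
  have entry: "A $$ (i, j) = t * X $$ (i, j) + (1 - t) * Y $$ (i, j)" if "i < n" "j < m" for i j
    using that carr by (subst comb) auto
  have "t \<noteq> 0"
  proof
    assume "t = 0"
    then have "Y = A" using carr by (intro eq_matI) (auto simp: entry)
    then show False using ne by simp
  qed
  then have "t > 0" using t by simp
  have "X = A"
  proof (rule unique[OF X])
    fix i j assume ij: "i < n" "j < m" and "A $$ (i, j) = 0"
    then have "t * X $$ (i, j) + (1 - t) * Y $$ (i, j) = 0" using entry by simp
    moreover have "t * X $$ (i, j) \<ge> 0" "(1 - t) * Y $$ (i, j) \<ge> 0"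
      using ij X Y t by (auto simp: ds_arrays_def)
    ultimately have "t * X $$ (i, j) = 0" by linarith
    then show "X $$ (i, j) = 0" using \<open>t > 0\<close> by simp
  qed
  then show False using ne by simp
qed (rule A)

section \<open>Column supports under equivalence\<close>

lemma equivalent_mat_column_support:
  fixes A B :: "'a::zero mat"
  assumes "equivalent_mat A B" and "j < dim_col A"
  shows "\<exists>k < dim_col B.
    card {i. i < dim_row A \<and> A $$ (i, j) \<noteq> 0} = card {i. i < dim_row B \<and> B $$ (i, k) \<noteq> 0}"
proof -
  obtain p q where p: "p permutes {..<dim_row A}" and q: "q permutes {..<dim_col A}"
    and B: "B = mat (dim_row A) (dim_col A) (\<lambda>(i, j). A $$ (p i, q j))"
    using assms(1) by (auto simp: equivalent_mat_def)
  obtain k where k: "k < dim_col A" "q k = j"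
    using permutes_image[OF q] assms(2) by (metis imageE lessThan_iff)
  have "{i. i < dim_row A \<and> A $$ (i, j) \<noteq> 0} = p ` {i. i < dim_row B \<and> B $$ (i, k) \<noteq> 0}"
  proof safe
    fix i assume i: "i < dim_row A" "A $$ (i, j) \<noteq> 0"
    then obtain i' where "i' < dim_row A" "p i' = i"
      using permutes_image[OF p] by (metis imageE lessThan_iff)
    then show "i \<in> p ` {i. i < dim_row B \<and> B $$ (i, k) \<noteq> 0}"
      using i k by (auto simp: B)
  next
    fix i assume "i < dim_row B" "B $$ (i, k) \<noteq> 0"
    then show "p i < dim_row A" "A $$ (p i, j) = 0 \<Longrightarrow> False"
      using permutes_in_image[OF p, of i] k by (auto simp: B)
  qed
  moreover have "inj p" using p by (rule permutes_inj)
  ultimately have "card {i. i < dim_row A \<and> A $$ (i, j) \<noteq> 0}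
      = card {i. i < dim_row B \<and> B $$ (i, k) \<noteq> 0}"
    by (simp add: card_image inj_on_subset)
  then show ?thesis using k by (auto simp: B)
qed

section \<open>The array of a tree\<close>

text \<open>
  A tree on \<open>0, \<dots>, n\<close> is rooted at \<open>n\<close>, numbered so that parents come after their children, and given
  by its parent function \<open>p\<close>. The vertex \<open>i < n\<close> also names the edge from \<open>i\<close> to \<open>p i\<close>, which cuts off
  the subtree below \<open>i\<close>. The condition \<open>i < j\<close> below makes the recursion terminate for every \<open>p\<close>.
\<close>

function subtree_size :: "(nat \<Rightarrow> nat) \<Rightarrow> nat \<Rightarrow> nat" where
  "subtree_size p j = Suc (\<Sum>i | i < j \<and> p i = j. subtree_size p i)"
  by auto
termination by (relation "measure snd") auto

declare subtree_size.simps [simp del]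

definition tree_array :: "nat \<Rightarrow> (nat \<Rightarrow> nat) \<Rightarrow> real mat" where
  "tree_array n p = mat n (n + 1) (\<lambda>(i, j).
     if j = p i then real (subtree_size p i)
     else if j = i then real (n + 1) - real (subtree_size p i) else 0)"

locale increasing_tree =
  fixes n :: nat and p :: "nat \<Rightarrow> nat"
  assumes parent_greater: "i < n \<Longrightarrow> i < p i"
    and parent_le_root: "i < n \<Longrightarrow> p i \<le> n"
begin

lemma children_eq: "j \<le> n \<Longrightarrow> {i. i < j \<and> p i = j} = {i. i < n \<and> p i = j}"
  using parent_greater by auto

lemma subtree_size_eq:
  "j \<le> n \<Longrightarrow> subtree_size p j = Suc (\<Sum>i | i < n \<and> p i = j. subtree_size p i)"
  using subtree_size.simps[of p j] by (simp add: children_eq)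

lemma subtree_size_less_parent:
  assumes "i < n"
  shows "subtree_size p i < subtree_size p (p i)"
proof -
  have "subtree_size p i \<le> (\<Sum>k | k < n \<and> p k = p i. subtree_size p k)"
    using assms by (intro member_le_sum) auto
  then show ?thesis using subtree_size_eq[OF parent_le_root[OF assms]] by simp
qed

text \<open>
  Summing the recursion over all vertices counts the subtree of every vertex but the root once
  on each side, and these terms cancel.
\<close>

lemma subtree_size_root: "subtree_size p n = n + 1"
proof -
  have "(\<Sum>j\<le>n. subtree_size p j) = (\<Sum>j\<le>n. Suc (\<Sum>i | i < n \<and> p i = j. subtree_size p i))"
    by (intro sum.cong) (auto simp: subtree_size_eq)
  also have "\<dots> = (\<Sum>j\<le>n. \<Sum>i | i < n \<and> p i = j. subtree_size p i) + (n + 1)"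
    by (simp add: sum_Suc)
  also have "(\<Sum>j\<le>n. \<Sum>i | i < n \<and> p i = j. subtree_size p i) = (\<Sum>i<n. subtree_size p i)"
    using sum.group[of "{..<n}" "{..n}" p "subtree_size p"] parent_le_root by auto
  finally show ?thesis by (simp add: lessThan_Suc_atMost[symmetric])
qed

lemma subtree_size_le_root:
  assumes "i \<le> n"
  shows "subtree_size p i \<le> n + 1"
  using assms
proof (induction "n - i" arbitrary: i rule: less_induct)
  case less
  show ?case
  proof (cases "i = n")
    case False
    then have i: "i < n" using less.prems by simp
    have "n - p i < n - i" using i parent_greater[OF i] by simp
    then have "subtree_size p (p i) \<le> n + 1" using less.hyps parent_le_root[OF i] by blast
    then show ?thesis using subtree_size_less_parent[OF i] by simp
  qed (simp add: subtree_size_root)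
qed

lemma subtree_size_less:
  assumes "i < n"
  shows "subtree_size p i < n + 1"
  using subtree_size_less_parent[OF assms] subtree_size_le_root[OF parent_le_root[OF assms]]
  by simp

lemma subtree_size_pos: "0 < subtree_size p i"
  by (subst subtree_size.simps) simp

lemma tree_array_nonzero_iff:
  "i < n \<Longrightarrow> j \<le> n \<Longrightarrow> tree_array n p $$ (i, j) \<noteq> 0 \<longleftrightarrow> j = i \<or> j = p i"
  using subtree_size_less[of i] subtree_size_pos[of i] by (auto simp: tree_array_def)

text \<open>
  A row supported on the edge from \<open>i\<close> to \<open>p i\<close> has only two terms, and a column supported on the
  edges at \<open>j\<close> splits into the edge to the parent, absent at the root, and the edges to the children.
\<close>

lemma row_sum_on_tree:
  fixes f :: "nat \<Rightarrow> real"
  assumes "i < n" and "\<And>j. j \<le> n \<Longrightarrow> j \<noteq> i \<Longrightarrow> j \<noteq> p i \<Longrightarrow> f j = 0"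
  shows "(\<Sum>j<n + 1. f j) = f i + f (p i)"
proof -
  have "(\<Sum>j<n + 1. f j) = (\<Sum>j\<in>{i, p i}. f j)"
    using assms parent_le_root[of i] by (intro sum.mono_neutral_right) auto
  then show ?thesis using parent_greater[OF assms(1)] by simp
qed

lemma column_sum_on_tree:
  fixes f :: "nat \<Rightarrow> real"
  assumes "j \<le> n" and "\<And>i. i < n \<Longrightarrow> j \<noteq> i \<Longrightarrow> j \<noteq> p i \<Longrightarrow> f i = 0"
  shows "(\<Sum>i<n. f i) = (if j < n then f j else 0) + (\<Sum>i | i < n \<and> p i = j. f i)"
proof (cases "j < n")
  case True
  have "(\<Sum>i<n. f i) = (\<Sum>i\<in>insert j {i. i < n \<and> p i = j}. f i)"
    using assms True by (intro sum.mono_neutral_right) auto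
  also have "\<dots> = f j + (\<Sum>i | i < n \<and> p i = j. f i)"
    using parent_greater[OF True] by (subst sum.insert) auto
  finally show ?thesis using True by simp
next
  case False
  then have "(\<Sum>i<n. f i) = (\<Sum>i | i < n \<and> p i = j. f i)"
    using assms by (intro sum.mono_neutral_right) auto
  then show ?thesis using False by simp
qed

lemma tree_array_mem_ds_arrays: "tree_array n p \<in> ds_arrays n (n + 1)"
proof -
  let ?A = "tree_array n p"
  have parent_entry: "?A $$ (i, p i) = subtree_size p i" if "i < n" for i
    using that parent_le_root[of i] by (simp add: tree_array_def)
  have own_entry: "?A $$ (i, i) = real (n + 1) - subtree_size p i" if "i < n" for i
    using that parent_greater[of i] by (simp add: tree_array_def)
  have "(\<Sum>j<n + 1. ?A $$ (i, j)) = n + 1" if i: "i < n" for i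
  proof -
    have "(\<Sum>j<n + 1. ?A $$ (i, j)) = ?A $$ (i, i) + ?A $$ (i, p i)"
      using i tree_array_nonzero_iff by (intro row_sum_on_tree) auto
    then show ?thesis using i by (simp add: parent_entry own_entry)
  qed
  moreover have "(\<Sum>i<n. ?A $$ (i, j)) = n" if j: "j \<le> n" for j
  proof -
    have children: "(\<Sum>i | i < n \<and> p i = j. ?A $$ (i, j)) = real (subtree_size p j) - 1"
    proof -
      have "(\<Sum>i | i < n \<and> p i = j. ?A $$ (i, j))
          = (\<Sum>i | i < n \<and> p i = j. real (subtree_size p i))"
        using parent_entry by (intro sum.cong) auto
      then show ?thesis using subtree_size_eq[OF j] by simp
    qed
    have "(\<Sum>i<n. ?A $$ (i, j)) = (if j < n then ?A $$ (j, j) else 0)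
        + (\<Sum>i | i < n \<and> p i = j. ?A $$ (i, j))"
      using j tree_array_nonzero_iff by (intro column_sum_on_tree) auto
    then show ?thesis
      unfolding children using j subtree_size_root by (cases "j = n") (auto simp: own_entry)
  qed
  moreover have "0 \<le> ?A $$ (i, j)" if "i < n" "j < n + 1" for i j
    using that subtree_size_less[of i] by (auto simp: tree_array_def)
  ultimately show ?thesis by (auto simp: ds_arrays_def tree_array_def)
qed

text \<open>
  The flow is forced from the leaves upwards: once the flow from all children into the vertex \<open>i\<close> is
  known, the sum of column \<open>i\<close> gives the remaining entry of that column, and then the sum of row \<open>i\<close>
  gives the flow into the parent of \<open>i\<close>.
\<close>

lemma extremal_tree_array: "extremal_array n (n + 1) (tree_array n p)"
proof (rule extremal_array_if_determined_by_support[OF tree_array_mem_ds_arrays])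
  fix X assume X: "X \<in> ds_arrays n (n + 1)"
    and supp: "\<And>i j. i < n \<Longrightarrow> j < n + 1 \<Longrightarrow> tree_array n p $$ (i, j) = 0 \<Longrightarrow> X $$ (i, j) = 0"
  have zero: "X $$ (i, j) = 0" if "i < n" "j \<le> n" "j \<noteq> i" "j \<noteq> p i" for i j
    using that supp[of i j] tree_array_nonzero_iff[of i j] by auto
  have row: "X $$ (i, i) + X $$ (i, p i) = n + 1" if "i < n" for i
    using row_sum_on_tree[of i "\<lambda>j. X $$ (i, j)"] that zero X by (auto simp: ds_arrays_def)
  have column: "X $$ (i, i) + (\<Sum>k | k < n \<and> p k = i. X $$ (k, i)) = n" if "i < n" for i
    using column_sum_on_tree[of i "\<lambda>k. X $$ (k, i)"] that zero X by (auto simp: ds_arrays_def)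
  have flow: "X $$ (i, p i) = subtree_size p i" if "i < n" for i
    using that
  proof (induction i rule: less_induct)
    case (less i)
    have "(\<Sum>k | k < n \<and> p k = i. X $$ (k, i)) = (\<Sum>k | k < n \<and> p k = i. real (subtree_size p k))"
      using less.IH parent_greater by (intro sum.cong) auto
    also have "\<dots> = real (subtree_size p i) - 1"
      using subtree_size_eq[of i] less.prems by simp
    finally show ?case using row[OF less.prems] column[OF less.prems] by simp
  qed
  show "X = tree_array n p"
  proof (rule eq_matI)
    fix i j assume "i < dim_row (tree_array n p)" "j < dim_col (tree_array n p)"
    then have ij: "i < n" "j \<le> n" by (auto simp: tree_array_def)
    have "X $$ (i, i) = real (n + 1) - subtree_size p i"
      using row[OF ij(1)] flow[OF ij(1)] by simp
    then show "X $$ (i, j) = tree_array n p $$ (i, j)"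
      using ij zero[of i j] flow[of i] by (auto simp: tree_array_def)
  qed (use X in \<open>auto simp: ds_arrays_def tree_array_def\<close>)
qed

lemma entries_mset_row_tree_array:
  assumes "i < n"
  shows "image_mset (\<lambda>j. tree_array n p $$ (i, j)) (mset_set {..<n + 1}) =
    {#real (subtree_size p i), real (n + 1) - real (subtree_size p i)#} + replicate_mset (n - 1) 0"
proof -
  have split: "{..<n + 1} = insert (p i) (insert i ({..<n + 1} - {i, p i}))"
    using assms parent_le_root[of i] by auto
  have "card ({..<n + 1} - {i, p i}) = n - 1"
    using assms parent_le_root[of i] parent_greater[of i] by (subst card_Diff_subset) auto
  moreover have "image_mset (\<lambda>j. tree_array n p $$ (i, j)) (mset_set ({..<n + 1} - {i, p i}))
      = image_mset (\<lambda>j. 0) (mset_set ({..<n + 1} - {i, p i}))"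
    using assms by (intro image_mset_cong) (auto simp: tree_array_def)
  ultimately show ?thesis
    using assms parent_le_root[of i] parent_greater[of i]
    by (subst split) (auto simp: tree_array_def image_mset_const_eq)
qed

end

lemma entries_mset_by_rows:
  "entries_mset A = (\<Sum>i<dim_row A. image_mset (\<lambda>j. A $$ (i, j)) (mset_set {..<dim_col A}))"
proof -
  have "image_mset f (mset_set (I \<times> {..<m})) =
      (\<Sum>i\<in>I. image_mset (\<lambda>j. f (i, j)) (mset_set {..<m}))"
    if "finite I" for I :: "nat set" and f :: "nat \<times> nat \<Rightarrow> 'a" and m
    using that
  proof (induction I)
    case (insert i I)
    have "insert i I \<times> {..<m} = Pair i ` {..<m} \<union> I \<times> {..<m}" by auto
    moreover have "mset_set (Pair i ` {..<m} \<union> I \<times> {..<m})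
        = mset_set (Pair i ` {..<m}) + mset_set (I \<times> {..<m})"
      using insert.hyps by (intro mset_set_Union) auto
    moreover have "mset_set (Pair i ` {..<m}) = image_mset (Pair i) (mset_set {..<m})"
      by (simp add: image_mset_mset_set inj_on_def)
    ultimately show ?case using insert by (simp add: multiset.map_comp comp_def)
  qed simp
  then show ?thesis by (simp add: entries_mset_def)
qed

lemma entries_mset_tree_array_cong:
  assumes "increasing_tree n p" and "increasing_tree n q"
    and "\<And>i. i < n \<Longrightarrow> subtree_size p i = subtree_size q i"
  shows "entries_mset (tree_array n p) = entries_mset (tree_array n q)"
proof -
  have dims: "dim_row (tree_array n r) = n" "dim_col (tree_array n r) = n + 1" for r
    by (simp_all add: tree_array_def)
  show ?thesis
    unfolding entries_mset_by_rows dims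
    by (rule sum.cong) (simp_all only: lessThan_iff assms(3)
      increasing_tree.entries_mset_row_tree_array[OF assms(1)]
      increasing_tree.entries_mset_row_tree_array[OF assms(2)])
qed

section \<open>Two trees with the same edge splits\<close>

text \<open>
  In the first tree the path is \<open>0, 3, 4\<close>. In the second one the two paths are \<open>0, 3\<close> and \<open>1, 4, 2\<close>.
  All other vertices are attached to the centre \<open>n\<close>. The numbering is chosen so that the subtree at
  each single vertex \<open>i < n\<close>, and not just the multiset of sizes, is equally large in both trees.
\<close>

definition path_tree :: "nat \<Rightarrow> nat \<Rightarrow> nat" where
  "path_tree n i = (if i = 0 then 3 else if i = 3 then 4 else n)"

definition two_path_tree :: "nat \<Rightarrow> nat \<Rightarrow> nat" where
  "two_path_tree n i = (if i = 0 then 3 else if i = 1 \<or> i = 2 then 4 else n)"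

lemma increasing_path_tree: "n \<ge> 6 \<Longrightarrow> increasing_tree n (path_tree n)"
  by unfold_locales (auto simp: path_tree_def)

lemma increasing_two_path_tree: "n \<ge> 6 \<Longrightarrow> increasing_tree n (two_path_tree n)"
  by unfold_locales (auto simp: two_path_tree_def)

lemma subtree_size_path_tree:
  assumes "n \<ge> 6" and "i < n"
  shows "subtree_size (path_tree n) i = (if i = 3 then 2 else if i = 4 then 3 else 1)"
proof -
  have leaf: "subtree_size (path_tree n) j = 1" if "j < n" "j \<noteq> 3" "j \<noteq> 4" for j
  proof -
    have "{i. i < j \<and> path_tree n i = j} = {}" using that by (auto simp: path_tree_def)
    then show ?thesis
      using subtree_size.simps[of "path_tree n" j] by (simp only: sum.empty One_nat_def)
  qed
  have "{i. i < 3 \<and> path_tree n i = 3} = {0}" "{i. i < 4 \<and> path_tree n i = 4} = {3}"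
    using assms(1) by (auto simp: path_tree_def)
  then have "subtree_size (path_tree n) 3 = 2" "subtree_size (path_tree n) 4 = 3"
    using leaf[of 0] assms(1) subtree_size.simps[of "path_tree n" 3]
      subtree_size.simps[of "path_tree n" 4]
    by simp_all
  then show ?thesis using leaf assms(2) by auto
qed

lemma subtree_size_two_path_tree:
  assumes "n \<ge> 6" and "i < n"
  shows "subtree_size (two_path_tree n) i = (if i = 3 then 2 else if i = 4 then 3 else 1)"
proof -
  have leaf: "subtree_size (two_path_tree n) j = 1" if "j < n" "j \<noteq> 3" "j \<noteq> 4" for j
  proof -
    have "{i. i < j \<and> two_path_tree n i = j} = {}" using that by (auto simp: two_path_tree_def)
    then show ?thesis
      using subtree_size.simps[of "two_path_tree n" j] by (simp only: sum.empty One_nat_def)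
  qed
  have "{i. i < 3 \<and> two_path_tree n i = 3} = {0}" "{i. i < 4 \<and> two_path_tree n i = 4} = {1, 2}"
    using assms(1) by (auto simp: two_path_tree_def)
  then have "subtree_size (two_path_tree n) 3 = 2" "subtree_size (two_path_tree n) 4 = 3"
    using leaf[of 0] leaf[of 1] leaf[of 2] assms(1) subtree_size.simps[of "two_path_tree n" 3]
      subtree_size.simps[of "two_path_tree n" 4]
    by simp_all
  then show ?thesis using leaf assms(2) by auto
qed

lemma card_column_support_path_tree_centre:
  assumes "n \<ge> 6"
  shows "card {i. i < n \<and> tree_array n (path_tree n) $$ (i, n) \<noteq> 0} = n - 2"
proof -
  have "{i. i < n \<and> tree_array n (path_tree n) $$ (i, n) \<noteq> 0}
      = {i. i < n \<and> (n = i \<or> n = path_tree n i)}"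
    using increasing_tree.tree_array_nonzero_iff[OF increasing_path_tree[OF assms]] by auto
  also have "\<dots> = {..<n} - {0, 3}" using assms by (auto simp: path_tree_def)
  finally show ?thesis using assms by (simp add: card_Diff_subset)
qed

lemma card_column_support_two_path_tree_le:
  assumes "n \<ge> 6" and "k \<le> n"
  shows "card {i. i < n \<and> tree_array n (two_path_tree n) $$ (i, k) \<noteq> 0} \<le> n - 3"
proof -
  have supp: "{i. i < n \<and> tree_array n (two_path_tree n) $$ (i, k) \<noteq> 0}
      = {i. i < n \<and> (k = i \<or> k = two_path_tree n i)}"
    using assms increasing_tree.tree_array_nonzero_iff[OF increasing_two_path_tree[OF assms(1)]]
    by auto
  show ?thesis
  proof (cases "k = n")
    case True
    have "card {i. i < n \<and> (k = i \<or> k = two_path_tree n i)} \<le> card ({..<n} - {0, 1, 2})"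
      using assms True by (intro card_mono) (auto simp: two_path_tree_def)
    then show ?thesis using assms by (simp add: supp card_Diff_subset)
  next
    case False
    \<comment> \<open>Edges at \<open>k\<close>, named by their lower ends: \<open>k\<close> itself and the children, of which only the vertex
      \<open>4\<close> has two. The resulting bound \<open>3\<close> is at most \<open>n - 3\<close> exactly when \<open>n \<ge> 6\<close>.\<close>
    let ?S = "if k = 4 then {1, 2, 4} else {0, k}"
    have "card {i. i < n \<and> (k = i \<or> k = two_path_tree n i)} \<le> card ?S"
      using assms False by (intro card_mono) (auto simp: two_path_tree_def)
    also have "card ?S \<le> 3" by (auto simp: card_insert_if)
    finally show ?thesis using assms by (simp add: supp)
  qed
qed

theorem theorem1p6:
  fixes n :: nat
  assumes "n \<ge> 6"
  shows "\<exists>A B :: real mat. extremal_array n (n + 1) A \<and> extremal_array n (n + 1) B \<and>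
           entries_mset A = entries_mset B \<and> \<not> equivalent_mat A B"
proof (intro exI conjI)
  let ?A = "tree_array n (path_tree n)" and ?B = "tree_array n (two_path_tree n)"
  note trees = increasing_path_tree[OF assms] increasing_two_path_tree[OF assms]
  show "extremal_array n (n + 1) ?A"
    by (rule increasing_tree.extremal_tree_array[OF trees(1)])
  show "extremal_array n (n + 1) ?B"
    by (rule increasing_tree.extremal_tree_array[OF trees(2)])
  show "entries_mset ?A = entries_mset ?B"
    using trees assms
    by (intro entries_mset_tree_array_cong)
      (auto simp: subtree_size_path_tree subtree_size_two_path_tree)
  show "\<not> equivalent_mat ?A ?B"
  proof
    assume "equivalent_mat ?A ?B"
    from equivalent_mat_column_support[OF this, of n] obtain k where "k \<le> n"
      and "card {i. i < n \<and> ?A $$ (i, n) \<noteq> 0} = card {i. i < n \<and> ?B $$ (i, k) \<noteq> 0}"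
      by (auto simp: tree_array_def less_Suc_eq_le)
    then have "n - 2 \<le> n - 3"
      using card_column_support_path_tree_centre[OF assms]
        card_column_support_two_path_tree_le[OF assms] by simp
    then show False using assms by simp
  qed
qed

end
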